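(* Let $m\in\mathcal X^m$ and $\Gamma:=\Phi(m,\mathcal X^s)-H(m)$, and assume all stable states lie in one cycle, namely in $\mathcal C^{\mathcal X^s}_m(\Gamma+H(m)-H(\mathcal X^s))$. Let $\mathcal W(m,\mathcal X^s)$ be a gate for the transition $m\to\mathcal X^s$, and let $K$, $\widetilde K$ be the associated sets of saddles defined in the context. Assume there are two sets of configurations $\mathcal L^G,\mathcal L^B$ such that for every $\eta\in\mathcal W(m,\mathcal X^s)$: (a) there exist a path $\omega_1^G:\eta\to\mathcal L^G$ with $\max_{\sigma\in\omega^G_1}H(\sigma)\le\Gamma+H(m)$ and a path $\omega_2^G:\mathcal L^G\to\mathcal X^s$ with $\max_{\sigma\in\omega^G_2}H(\sigma)<\Gamma+H(m)$; (b) there exists a path $\omega_1^B:\eta\to\mathcal L^B$ with $\max_{\sigma\in\omega_1^B}H(\sigma)\le\Gamma+H(m)$, and there is no path $\omega_2^B:\mathcal L^B\to\mathcal X^s$ and no path $\omega_2^B:\mathcal L^B\to m$ with $\max_{\sigma\in\omega_2^B}H(\sigma)<\Gamma+H(m)$. Then every saddle of the second type, i.e. every $$\zeta\in\partial\mathcal C_m^{\mathcal X^s}(\Gamma+H(m)-H(\mathcal X^s))\cap\big(\mathcal S(m,\mathcal X^s)\setminus(\mathcal W(m,\mathcal X^s)\cup\widetilde K)\big),$$ is unessential, and therefore $\zeta\notin\mathcal G(m,\mathcal X^s)$.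
   Context: $\mathcal X$ is a finite state space, $H:\mathcal X\to\mathbb R$ a Hamiltonian, and the dynamics is an irreducible Metropolis chain: for $\eta\ne\eta'$, $P(\eta,\eta')=q(\eta,\eta')e^{-\beta[H(\eta')-H(\eta)]_+}$ with $q$ symmetric and irreducible. A path $\omega:\eta\to\eta'$ is a finite sequence $(\omega_1,\dots,\omega_k)$ with $\omega_1=\eta$, $\omega_k=\eta'$, $P(\omega_i,\omega_{i+1})>0$; $\omega_1\circ\omega_2$ denotes concatenation of paths. In (a), (b) the existence (resp. non-existence) of a path starting from $\mathcal L^G$ (resp. $\mathcal L^B$) refers to every starting configuration in that set; in particular (a) implies $\mathcal L^G\subset\mathcal C_m^{\mathcal X^s}(\Gamma+H(m)-H(\mathcal X^s))$. Communication height: $\Phi(\eta,\eta')=\min_{\omega:\eta\to\eta'}\max_{\zeta\in\omega}H(\zeta)$, and for sets $\Phi(\mathcal A,\mathcal B)=\min_{\eta\in\mathcal A,\eta'\in\mathcal B}\Phi(\eta,\eta')$. $\mathcal X^s$ is the set of global minima of $H$ (stable states), with common energy $H(\mathcal X^s)$. Stability level: $V_\zeta=\Phi(\zeta,\mathcal I_\zeta)-H(\zeta)$ with $\mathcal I_\zeta=\{\eta:H(\eta)<H(\zeta)\}$ ($V_\zeta=\infty$ if $\mathcal I_\zeta=\emptyset$). Metastable states: $\mathcal X^m=\{\eta:V_\eta=\max_{\zeta\in\mathcal X\setminus\mathcal X^s}V_\zeta\}$. Optimal paths from $m$ to $\mathcal X^s$, $(m\to\mathcal X^s)_{opt}$: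 paths $\omega$ from $m$ to $\mathcal X^s$ with $\max_\omega H=\Phi(m,\mathcal X^s)$. Saddles: $\mathcal S(m,\mathcal X^s)=\{\zeta:\exists\,\omega\in(m\to\mathcal X^s)_{opt},\ \omega\ni\zeta,\ \max_\omega H=H(\zeta)\}$. $\arg\max_\omega H$ is the set of configurations of $\omega$ with maximal energy along $\omega$. A saddle $\xi$ is unessential if for every optimal $\omega$ with $\xi\in\omega$ one has $\arg\max_\omega H\setminus\{\xi\}\neq\emptyset$ and there is an optimal $\omega'$ with $\arg\max_{\omega'}H\subseteq\arg\max_\omega H\setminus\{\xi\}$. A gate is a set $\mathcal W\subseteq\mathcal S(m,\mathcal X^s)$ met by every optimal path; a minimal gate is a gate such that for every $\mathcal W'\subsetneq\mathcal W$ some optimal path avoids $\mathcal W'$; $\mathcal G(m,\mathcal X^s)$ is the union of all minimal gates. Initial cycles: $\mathcal C^m_{\mathcal X^s}(\Gamma)=\{m\}\cup\{\eta:\Phi(m,\eta)-H(m)<\Gamma\}$ and $\mathcal C^{\mathcal X^s}_m(\Gamma+H(m)-H(\mathcal X^s))=\mathcal X^s\cup\{\eta:\Phi(\mathcal X^s,\eta)<\Gamma+H(m)\}$. All stable states lie in one cycle means that they communicate with each other at height strictly below $\Gamma+H(m)$. For $\mathcal A\subset\mathcal X$, $\partial\mathcal A=\{\eta\notin\mathcal A:\exists\,\zeta\in\mathcal A,\ P(\zeta,\eta)>0\}$. $K$ is the set of $\bar\eta\in\mathcal S(m,\mathcal X^s)\setminus\mathcal W(m,\mathcal X^s)$ for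 which there exist $\eta\in\mathcal W(m,\mathcal X^s)$ and $\omega=\omega_1\circ\omega_2$ with $\max_{\sigma\in\omega}H(\sigma)\le\Gamma+H(m)$, where $\omega_1:\eta\to\bar\eta$ satisfies $\omega_1\cap\mathcal W(m,\mathcal X^s)=\{\eta\}$ and $\omega_1\cap\mathcal C^m_{\mathcal X^s}(\Gamma)=\emptyset$, and $\omega_2:\bar\eta\to m$ satisfies $\omega_2\cap\mathcal W(m,\mathcal X^s)=\emptyset$. $\widetilde K$ is the set of $\bar\eta\in\mathcal S(m,\mathcal X^s)\setminus\mathcal W(m,\mathcal X^s)$ for which there exist $\eta\in\mathcal W(m,\mathcal X^s)$ and $\omega=\omega_1\circ\omega_2$ with $\max_{\sigma\in\omega}H(\sigma)\le\Gamma+H(m)$, where $\omega_1:\eta\to\bar\eta$ satisfies $\omega_1\cap\mathcal W(m,\mathcal X^s)=\{\eta\}$ and $\omega_1\cap\mathcal C_m^{\mathcal X^s}(\Gamma+H(m)-H(\mathcal X^s))=\emptyset$, and $\omega_2:\bar\eta\to\mathcal X^s$ satisfies $\omega_2\cap\mathcal W(m,\mathcal X^s)=\emptyset$. *)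

theory Defs
  imports Complex_Main "HOL-Library.Extended_Real"
begin

section \<open>Metropolis dynamics on a finite state space\<close>

definition irreducible_matrix :: "('a \<Rightarrow> 'a \<Rightarrow> real) \<Rightarrow> bool" where
  "irreducible_matrix Q \<longleftrightarrow> (\<forall>\<eta> \<eta>'. (\<lambda>x y. Q x y > 0)\<^sup>*\<^sup>* \<eta> \<eta>')"

definition stochastic_matrix :: "('a::finite \<Rightarrow> 'a \<Rightarrow> real) \<Rightarrow> bool" where
  "stochastic_matrix Q \<longleftrightarrow> (\<forall>\<eta> \<eta>'. Q \<eta> \<eta>' \<ge> 0) \<and> (\<forall>\<eta>. (\<Sum>\<eta>'\<in>UNIV. Q \<eta> \<eta>') = 1)"

text \<open>The diagonal of \<open>P\<close> is determined by stochasticity; whether \<open>P \<eta> \<eta>\<close> vanishes is left open,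
  so a path may or may not be allowed to stay put.\<close>

definition metropolis :: "real \<Rightarrow> ('a::finite \<Rightarrow> 'a \<Rightarrow> real) \<Rightarrow> ('a \<Rightarrow> real) \<Rightarrow> ('a \<Rightarrow> 'a \<Rightarrow> real) \<Rightarrow> bool" where
  "metropolis \<beta> q H P \<longleftrightarrow>
     \<beta> > 0 \<and>
     (\<forall>\<eta> \<eta>'. q \<eta> \<eta>' \<ge> 0) \<and> (\<forall>\<eta> \<eta>'. q \<eta> \<eta>' = q \<eta>' \<eta>) \<and> irreducible_matrix q \<and>
     stochastic_matrix P \<and>
     (\<forall>\<eta> \<eta>'. \<eta> \<noteq> \<eta>' \<longrightarrow> P \<eta> \<eta>' = q \<eta> \<eta>' * exp (- \<beta> * max (H \<eta>' - H \<eta>) 0))"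

section \<open>Paths and communication height\<close>

text \<open>One-element sequences are paths, from a configuration to itself.\<close>

definition is_path :: "('a \<Rightarrow> 'a \<Rightarrow> real) \<Rightarrow> 'a \<Rightarrow> 'a list \<Rightarrow> 'a \<Rightarrow> bool" where
  "is_path P \<eta> \<omega> \<eta>' \<longleftrightarrow>
     \<omega> \<noteq> [] \<and> hd \<omega> = \<eta> \<and> last \<omega> = \<eta>' \<and> successively (\<lambda>x y. P x y > 0) \<omega>"

text \<open>Concatenation of two paths, the second starting where the first ends; the common endpoint
  is listed once.\<close>

definition path_concat :: "'a list \<Rightarrow> 'a list \<Rightarrow> 'a list" where
  "path_concat \<omega>\<^sub>1 \<omega>\<^sub>2 = \<omega>\<^sub>1 @ tl \<omega>\<^sub>2"

definition path_max :: "('a \<Rightarrow> real) \<Rightarrow> 'a list \<Rightarrow> real" where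
  "path_max H \<omega> = Max (H ` set \<omega>)"

definition path_argmax :: "('a \<Rightarrow> real) \<Rightarrow> 'a list \<Rightarrow> 'a set" where
  "path_argmax H \<omega> = {\<zeta> \<in> set \<omega>. H \<zeta> = path_max H \<omega>}"

text \<open>The minimum over the (possibly infinitely many) paths is taken over the values of
  \<open>path_max\<close>, which form a subset of the finite set \<open>range H\<close>, nonempty by irreducibility.\<close>

definition comm_height :: "('a::finite \<Rightarrow> real) \<Rightarrow> ('a \<Rightarrow> 'a \<Rightarrow> real) \<Rightarrow> 'a \<Rightarrow> 'a \<Rightarrow> real" where
  "comm_height H P \<eta> \<eta>' = Min {path_max H \<omega> |\<omega>. is_path P \<eta> \<omega> \<eta>'}"

definition comm_height_set :: "('a::finite \<Rightarrow> real) \<Rightarrow> ('a \<Rightarrow> 'a \<Rightarrow> real) \<Rightarrow> 'a set \<Rightarrow> 'a set \<Rightarrow> real" where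
  "comm_height_set H P A B = Min {comm_height H P \<eta> \<eta>' |\<eta> \<eta>'. \<eta> \<in> A \<and> \<eta>' \<in> B}"

section \<open>Stable and metastable states\<close>

definition stable_states :: "('a \<Rightarrow> real) \<Rightarrow> 'a set" where
  "stable_states H = {\<eta>. \<forall>\<eta>'. H \<eta> \<le> H \<eta>'}"

definition lower_states :: "('a \<Rightarrow> real) \<Rightarrow> 'a \<Rightarrow> 'a set" where
  "lower_states H \<zeta> = {\<eta>. H \<eta> < H \<zeta>}"

definition stability_level :: "('a::finite \<Rightarrow> real) \<Rightarrow> ('a \<Rightarrow> 'a \<Rightarrow> real) \<Rightarrow> 'a \<Rightarrow> ereal" where
  "stability_level H P \<zeta> =
     (if lower_states H \<zeta> = {} then \<infinity>
      else ereal (comm_height_set H P {\<zeta>} (lower_states H \<zeta>) - H \<zeta>))"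

text \<open>The supremum is a maximum whenever some state is not stable. If all states are stable it is
  \<open>-\<infinity>\<close>, and there are no metastable states.\<close>

definition metastable_states :: "('a::finite \<Rightarrow> real) \<Rightarrow> ('a \<Rightarrow> 'a \<Rightarrow> real) \<Rightarrow> 'a set" where
  "metastable_states H P =
     {\<eta>. stability_level H P \<eta> = (SUP \<zeta>\<in>UNIV - stable_states H. stability_level H P \<zeta>)}"

section \<open>Optimal paths, saddles and gates\<close>

definition optimal_paths :: "('a::finite \<Rightarrow> real) \<Rightarrow> ('a \<Rightarrow> 'a \<Rightarrow> real) \<Rightarrow> 'a \<Rightarrow> 'a set \<Rightarrow> 'a list set" where
  "optimal_paths H P m B =
     {\<omega>. (\<exists>s\<in>B. is_path P m \<omega> s) \<and> path_max H \<omega> = comm_height_set H P {m} B}"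

definition saddles :: "('a::finite \<Rightarrow> real) \<Rightarrow> ('a \<Rightarrow> 'a \<Rightarrow> real) \<Rightarrow> 'a \<Rightarrow> 'a set \<Rightarrow> 'a set" where
  "saddles H P m B = {\<zeta>. \<exists>\<omega>\<in>optimal_paths H P m B. \<zeta> \<in> set \<omega> \<and> path_max H \<omega> = H \<zeta>}"

definition unessential :: "('a::finite \<Rightarrow> real) \<Rightarrow> ('a \<Rightarrow> 'a \<Rightarrow> real) \<Rightarrow> 'a \<Rightarrow> 'a set \<Rightarrow> 'a \<Rightarrow> bool" where
  "unessential H P m B \<xi> \<longleftrightarrow>
     \<xi> \<in> saddles H P m B \<and>
     (\<forall>\<omega>\<in>optimal_paths H P m B. \<xi> \<in> set \<omega> \<longrightarrow>
        path_argmax H \<omega> - {\<xi>} \<noteq> {} \<and>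
        (\<exists>\<omega>'\<in>optimal_paths H P m B. path_argmax H \<omega>' \<subseteq> path_argmax H \<omega> - {\<xi>}))"

definition is_gate :: "('a::finite \<Rightarrow> real) \<Rightarrow> ('a \<Rightarrow> 'a \<Rightarrow> real) \<Rightarrow> 'a \<Rightarrow> 'a set \<Rightarrow> 'a set \<Rightarrow> bool" where
  "is_gate H P m B W \<longleftrightarrow>
     W \<subseteq> saddles H P m B \<and> (\<forall>\<omega>\<in>optimal_paths H P m B. set \<omega> \<inter> W \<noteq> {})"

definition is_minimal_gate :: "('a::finite \<Rightarrow> real) \<Rightarrow> ('a \<Rightarrow> 'a \<Rightarrow> real) \<Rightarrow> 'a \<Rightarrow> 'a set \<Rightarrow> 'a set \<Rightarrow> bool" where
  "is_minimal_gate H P m B W \<longleftrightarrow>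
     is_gate H P m B W \<and> (\<forall>W'. W' \<subset> W \<longrightarrow> (\<exists>\<omega>\<in>optimal_paths H P m B. set \<omega> \<inter> W' = {}))"

definition minimal_gates_union :: "('a::finite \<Rightarrow> real) \<Rightarrow> ('a \<Rightarrow> 'a \<Rightarrow> real) \<Rightarrow> 'a \<Rightarrow> 'a set \<Rightarrow> 'a set" where
  "minimal_gates_union H P m B = \<Union>{W. is_minimal_gate H P m B W}"

section \<open>The initial cycle of the stable states\<close>

definition boundary :: "('a \<Rightarrow> 'a \<Rightarrow> real) \<Rightarrow> 'a set \<Rightarrow> 'a set" where
  "boundary P A = {\<eta>. \<eta> \<notin> A \<and> (\<exists>\<zeta>\<in>A. P \<zeta> \<eta> > 0)}"

text \<open>The cycle of depth \<open>\<Gamma> + H m - H(X\<^sup>s)\<close> around the set \<open>X\<^sup>s\<close> of stable states: its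
  elements are reached from \<open>X\<^sup>s\<close> strictly below the energy \<open>\<Gamma> + H m\<close>.\<close>

definition stable_cycle :: "('a::finite \<Rightarrow> real) \<Rightarrow> ('a \<Rightarrow> 'a \<Rightarrow> real) \<Rightarrow> 'a \<Rightarrow> real \<Rightarrow> 'a set" where
  "stable_cycle H P m \<Gamma> =
     stable_states H \<union> {\<eta>. comm_height_set H P (stable_states H) {\<eta>} < \<Gamma> + H m}"

definition K_tilde :: "('a::finite \<Rightarrow> real) \<Rightarrow> ('a \<Rightarrow> 'a \<Rightarrow> real) \<Rightarrow> 'a \<Rightarrow> real \<Rightarrow> 'a set \<Rightarrow> 'a set" where
  "K_tilde H P m \<Gamma> W =
     {\<eta>\<^sub>b \<in> saddles H P m (stable_states H) - W.
        \<exists>\<eta>\<in>W. \<exists>\<omega>\<^sub>1 \<omega>\<^sub>2. \<exists>s\<in>stable_states H.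
          is_path P \<eta> \<omega>\<^sub>1 \<eta>\<^sub>b \<and> is_path P \<eta>\<^sub>b \<omega>\<^sub>2 s \<and>
          path_max H (path_concat \<omega>\<^sub>1 \<omega>\<^sub>2) \<le> \<Gamma> + H m \<and>
          set \<omega>\<^sub>1 \<inter> W = {\<eta>} \<and> set \<omega>\<^sub>1 \<inter> stable_cycle H P m \<Gamma> = {} \<and>
          set \<omega>\<^sub>2 \<inter> W = {}}"

end

theory Submission
  imports Defs
begin

text \<open>
  Write \<open>h = \<Gamma> + H m\<close> for the communication height between \<open>m\<close> and the stable states, and \<open>C\<close>
  for the cycle of the stable states. From every point of \<open>C\<close> one can descend to a stable state
  strictly below \<open>h\<close> (\<open>stable_cycle_descent\<close>). Hence an optimal path may be cut at its first entrance
  into \<open>C\<close> and continued by such a descent: the result is again optimal, and its saddles are among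
  those that the original path visited before entering \<open>C\<close>.

  The heart of the proof is that a saddle \<open>\<zeta>\<close> of the second type is never visited before that
  first entrance (\<open>second_type_saddle_not_before_entrance\<close>). From \<open>\<zeta>\<close> one step leads into \<open>C\<close>, and
  from there to a stable state below \<open>h\<close>, thus away from the gate \<open>W\<close>, all of whose points have energy
  \<open>h\<close>. If the path has met \<open>W\<close> before \<open>\<zeta>\<close>, its piece from the last such visit to \<open>\<zeta>\<close>,
  followed by this exit, exhibits \<open>\<zeta>\<close> as a point of \<open>K_tilde\<close>. If it has not, its piece from \<open>m\<close> to
  \<open>\<zeta>\<close>, followed by this exit, is an optimal path avoiding the gate. Both are excluded.

  So rerouting an optimal path removes \<open>\<zeta>\<close> and adds no saddle. The
  path also has a saddle other than \<open>\<zeta>\<close>, namely its point in \<open>W\<close>. This is unessentiality, and an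
  unessential saddle lies in no minimal gate (\<open>unessential_not_in_minimal_gates\<close>): if it did, it
  would be the only gate point on some optimal path, and removing it would bypass the gate.
\<close>

section \<open>Paths\<close>

lemma is_path_prefix: "is_path P x (us @ c # vs) y \<Longrightarrow> is_path P x (us @ [c]) c"
  by (auto simp: is_path_def successively_append_iff hd_append split: if_splits)

lemma is_path_suffix: "is_path P x (us @ c # vs) y \<Longrightarrow> is_path P c (c # vs) y"
  by (auto simp: is_path_def successively_append_iff)

lemma is_path_append:
  assumes "is_path P x (us @ [c]) c" and "is_path P c \<rho> y"
  shows "is_path P x (us @ \<rho>) y"
  using assms by (auto simp: is_path_def successively_append_iff hd_append split: if_splits)

lemma is_path_step: "P x c > 0 \<Longrightarrow> is_path P c \<rho> y \<Longrightarrow> is_path P x (x # \<rho>) y"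
  by (auto simp: is_path_def successively_Cons)

lemma is_path_rev:
  assumes "\<And>x y. P x y > 0 \<Longrightarrow> P y x > 0" and "is_path P x \<omega> y"
  shows "is_path P y (rev \<omega>) x"
  using assms by (auto simp: is_path_def hd_rev last_rev intro: successively_mono)

lemma path_max_less_iff: "\<omega> \<noteq> [] \<Longrightarrow> path_max H \<omega> < h \<longleftrightarrow> (\<forall>z\<in>set \<omega>. H z < h)"
  by (simp add: path_max_def)

lemma path_max_le_iff: "\<omega> \<noteq> [] \<Longrightarrow> path_max H \<omega> \<le> h \<longleftrightarrow> (\<forall>z\<in>set \<omega>. H z \<le> h)"
  by (simp add: path_max_def)

lemma metropolis_symmetric_steps: "metropolis \<beta> q H P \<Longrightarrow> P x y > 0 \<Longrightarrow> P y x > 0"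
  by (cases "x = y") (auto simp: metropolis_def zero_less_mult_iff)

lemma metropolis_paths_exist:
  assumes "metropolis \<beta> q H P"
  shows "\<exists>\<omega>. is_path P x \<omega> y"
proof -
  have "(\<lambda>x y. q x y > 0)\<^sup>*\<^sup>* x y"
    using assms by (simp add: metropolis_def irreducible_matrix_def)
  then show ?thesis
  proof (induction rule: converse_rtranclp_induct)
    case base
    have "is_path P y [y] y" by (simp add: is_path_def)
    then show ?case ..
  next
    case (step x z)
    show ?case
    proof (cases "x = z")
      \<comment> \<open>The diagonal of \<open>P\<close> may vanish where that of \<open>q\<close> does not, so such a step is skipped.\<close>
      case True
      then show ?thesis using step by simp
    next
      case False
      then have "P x z > 0" using assms step.hyps by (simp add: metropolis_def)
      then show ?thesis using step.IH is_path_step by metis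
    qed
  qed
qed

section \<open>Communication heights\<close>

lemma finite_path_maxima: "finite {path_max H \<omega> |\<omega>. is_path P x \<omega> (y::'a::finite)}"
proof (rule finite_subset)
  show "{path_max H \<omega> |\<omega>. is_path P x \<omega> y} \<subseteq> range H"
  proof clarify
    fix \<omega> assume "is_path P x \<omega> y"
    then have "Max (H ` set \<omega>) \<in> H ` set \<omega>" by (intro Max_in) (auto simp: is_path_def)
    then show "path_max H \<omega> \<in> range H" by (auto simp: path_max_def)
  qed
qed simp

lemma finite_comm_heights:
  "finite {comm_height H P x y |x y. x \<in> A \<and> (y::'a::finite) \<in> B}"
  by (rule finite_subset[of _ "range (\<lambda>(x, y). comm_height H P x y)"]) auto

lemma comm_height_attained:
  assumes "\<exists>\<omega>. is_path P x \<omega> y"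
  shows "\<exists>\<omega>. is_path P x \<omega> y \<and> path_max H \<omega> = comm_height H P x y"
proof -
  have "comm_height H P x y \<in> {path_max H \<omega> |\<omega>. is_path P x \<omega> y}"
    unfolding comm_height_def using assms by (intro Min_in finite_path_maxima) auto
  then show ?thesis by auto
qed

lemma comm_height_set_attained:
  assumes "A \<noteq> {}" "B \<noteq> {}"
  shows "\<exists>x\<in>A. \<exists>y\<in>B. comm_height H P x y = comm_height_set H P A B"
proof -
  have "comm_height_set H P A B \<in> {comm_height H P x y |x y. x \<in> A \<and> y \<in> B}"
    unfolding comm_height_set_def using assms by (intro Min_in finite_comm_heights) auto
  then show ?thesis by force
qed

lemma comm_height_set_le_path_max:
  assumes "is_path P x \<omega> y" "x \<in> A" "y \<in> B"
  shows "comm_height_set H P A B \<le> path_max H \<omega>"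
proof -
  have "comm_height_set H P A B \<le> comm_height H P x y"
    unfolding comm_height_set_def using assms by (intro Min_le finite_comm_heights) auto
  also have "\<dots> \<le> path_max H \<omega>"
    unfolding comm_height_def using assms by (intro Min_le finite_path_maxima) auto
  finally show ?thesis .
qed

lemma stable_states_nonempty: "stable_states (H :: 'a::finite \<Rightarrow> real) \<noteq> {}"
proof -
  have "Min (range H) \<in> range H" by (intro Min_in) auto
  then obtain s where "H s = Min (range H)" by (metis imageE)
  then have "s \<in> stable_states H" by (simp add: stable_states_def)
  then show ?thesis by auto
qed

text \<open>The communication height is a lower bound for every path, so optimality of a path
  needs only the upper bound.\<close>

lemma optimal_pathI:
  assumes "is_path P m \<omega> s" "s \<in> B" and "\<forall>z\<in>set \<omega>. H z \<le> comm_height_set H P {m} B"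
  shows "\<omega> \<in> optimal_paths H P m B"
proof -
  have "path_max H \<omega> \<le> comm_height_set H P {m} B"
    using assms by (subst path_max_le_iff) (auto simp: is_path_def)
  moreover have "comm_height_set H P {m} B \<le> path_max H \<omega>"
    using assms by (intro comm_height_set_le_path_max) auto
  ultimately show ?thesis using assms by (auto simp: optimal_paths_def)
qed

lemma optimal_path_bounded:
  assumes "\<omega> \<in> optimal_paths H P m B" "z \<in> set \<omega>"
  shows "H z \<le> comm_height_set H P {m} B"
  using assms path_max_le_iff[of \<omega> H "comm_height_set H P {m} B"]
  by (auto simp: optimal_paths_def is_path_def)

lemma optimal_path_argmax:
  "\<omega> \<in> optimal_paths H P m B \<Longrightarrow>
     path_argmax H \<omega> = {z \<in> set \<omega>. H z = comm_height_set H P {m} B}"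
  by (simp add: optimal_paths_def path_argmax_def)

lemma saddle_energy: "\<zeta> \<in> saddles H P m B \<Longrightarrow> H \<zeta> = comm_height_set H P {m} B"
  by (auto simp: saddles_def optimal_paths_def)

section \<open>Unessential saddles and minimal gates\<close>

text \<open>By minimality, a point \<open>\<xi>\<close> of a minimal gate is the only gate point on some optimal path. If
  \<open>\<xi>\<close> were unessential, an optimal path with fewer maximal points would avoid \<open>\<xi>\<close>; its own gate
  point, being a saddle, would be a second gate point on the first path.\<close>

lemma unessential_not_in_minimal_gates:
  assumes "unessential H P m B \<xi>"
  shows "\<xi> \<notin> minimal_gates_union H P m B"
proof
  assume "\<xi> \<in> minimal_gates_union H P m B"
  then obtain W where W: "is_minimal_gate H P m B W" "\<xi> \<in> W"
    by (auto simp: minimal_gates_union_def)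
  have gate: "W \<subseteq> saddles H P m B" "\<And>\<omega>. \<omega> \<in> optimal_paths H P m B \<Longrightarrow> set \<omega> \<inter> W \<noteq> {}"
    using W by (auto simp: is_minimal_gate_def is_gate_def)
  have "W - {\<xi>} \<subset> W" using W by auto
  then obtain \<omega> where \<omega>: "\<omega> \<in> optimal_paths H P m B" "set \<omega> \<inter> (W - {\<xi>}) = {}"
    using W unfolding is_minimal_gate_def by blast
  then have "\<xi> \<in> set \<omega>" using gate(2) by blast
  then obtain \<omega>' where \<omega>': "\<omega>' \<in> optimal_paths H P m B"
      "path_argmax H \<omega>' \<subseteq> path_argmax H \<omega> - {\<xi>}"
    using assms \<omega> unfolding unessential_def by blast
  obtain w where w: "w \<in> set \<omega>'" "w \<in> W" using gate(2)[OF \<omega>'(1)] by auto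
  then have "w \<in> path_argmax H \<omega>'"
    using gate(1) saddle_energy optimal_path_argmax[OF \<omega>'(1)] by blast
  then have "w \<in> set \<omega>" "w \<noteq> \<xi>" using \<omega>'(2) by (auto simp: path_argmax_def)
  then show False using \<omega>(2) w by auto
qed

section \<open>Entering the cycle of the stable states\<close>

text \<open>The cycle is defined by paths that start from the stable states; reversibility of the dynamics
  turns them around. For a stable state itself, that its energy lies below \<open>\<Gamma> + H m\<close>
  is part of the assumption that all stable states lie in one cycle.\<close>

lemma stable_cycle_descent:
  assumes chain: "metropolis \<beta> q H P"
    and one_cycle: "\<forall>s\<in>stable_states H. \<forall>s'\<in>stable_states H. comm_height H P s s' < \<Gamma> + H m"
    and c: "c \<in> stable_cycle H P m \<Gamma>"
  obtains s \<rho> where "s \<in> stable_states H" "is_path P c \<rho> s" "\<forall>z\<in>set \<rho>. H z < \<Gamma> + H m"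
proof -
  have "\<exists>s\<in>stable_states H. comm_height H P s c < \<Gamma> + H m"
  proof (cases "c \<in> stable_states H")
    case True
    then show ?thesis using one_cycle by blast
  next
    case False
    then have "comm_height_set H P (stable_states H) {c} < \<Gamma> + H m"
      using c by (simp add: stable_cycle_def)
    then show ?thesis
      using comm_height_set_attained[OF stable_states_nonempty, of "{c}" H H P] by force
  qed
  then obtain s where s: "s \<in> stable_states H" "comm_height H P s c < \<Gamma> + H m" by blast
  obtain \<omega> where \<omega>: "is_path P s \<omega> c" "path_max H \<omega> = comm_height H P s c"
    using comm_height_attained metropolis_paths_exist[OF chain] by metis
  have "is_path P c (rev \<omega>) s"
    using \<omega>(1) metropolis_symmetric_steps[OF chain] by (intro is_path_rev)
  moreover have "\<forall>z\<in>set (rev \<omega>). H z < \<Gamma> + H m"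
    using \<omega> s path_max_less_iff[of \<omega> H] by (simp add: is_path_def)
  ultimately show ?thesis using s(1) that by blast
qed

text \<open>Otherwise the path from \<open>m\<close> to the first visit of \<open>\<zeta>\<close>, continued through \<open>C\<close> to a stable
  state, either avoids the gate or its part after the last gate point puts \<open>\<zeta>\<close> into \<open>K_tilde\<close>. That
  the path has not entered \<open>C\<close> before \<open>\<zeta>\<close> is what \<open>K_tilde\<close> requires of its first piece.\<close>

lemma second_type_saddle_not_before_entrance:
  assumes chain: "metropolis \<beta> q H P"
    and Gamma: "\<Gamma> = comm_height_set H P {m} (stable_states H) - H m"
    and one_cycle: "\<forall>s\<in>stable_states H. \<forall>s'\<in>stable_states H. comm_height H P s s' < \<Gamma> + H m"
    and gate: "is_gate H P m (stable_states H) W"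
    and \<zeta>: "\<zeta> \<in> boundary P (stable_cycle H P m \<Gamma>)"
      "\<zeta> \<in> saddles H P m (stable_states H)" "\<zeta> \<notin> W" "\<zeta> \<notin> K_tilde H P m \<Gamma> W"
    and path: "is_path P m (us @ vs) y"
    and below: "\<forall>z\<in>set us. H z \<le> \<Gamma> + H m"
    and outside: "set us \<inter> stable_cycle H P m \<Gamma> = {}"
  shows "\<zeta> \<notin> set us"
proof
  assume "\<zeta> \<in> set us"
  then obtain as bs where us: "us = as @ \<zeta> # bs" by (meson split_list)
  have h: "comm_height_set H P {m} (stable_states H) = \<Gamma> + H m" using Gamma by simp
  have W_energy: "H w = \<Gamma> + H m" if "w \<in> W" for w
    using gate that saddle_energy h by (fastforce simp: is_gate_def)
  obtain c where c: "c \<in> stable_cycle H P m \<Gamma>" "P c \<zeta> > 0"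
    using \<zeta>(1) by (auto simp: boundary_def)
  obtain s \<rho> where s: "s \<in> stable_states H" and \<rho>: "is_path P c \<rho> s" "\<forall>z\<in>set \<rho>. H z < \<Gamma> + H m"
    using stable_cycle_descent[OF chain one_cycle c(1)] .
  have exit_path: "is_path P \<zeta> (\<zeta> # \<rho>) s"
    using metropolis_symmetric_steps[OF chain c(2)] \<rho>(1) by (rule is_path_step)
  have exit_W: "set (\<zeta> # \<rho>) \<inter> W = {}" using W_energy \<rho>(2) \<zeta>(3) by fastforce
  have to_\<zeta>: "is_path P m (as @ [\<zeta>]) \<zeta>"
    using path is_path_prefix[of P m as \<zeta> "bs @ vs" y] by (simp add: us)
  show False
  proof (cases "\<exists>w\<in>set as. w \<in> W")
    case False
    have "as @ \<zeta> # \<rho> \<in> optimal_paths H P m (stable_states H)"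
      using is_path_append[OF to_\<zeta> exit_path] s
      by (rule optimal_pathI) (use below \<rho>(2) in \<open>auto simp: us h less_imp_le\<close>)
    then show False using gate False exit_W by (fastforce simp: is_gate_def)
  next
    case True
    then obtain as1 \<eta> as2 where as: "as = as1 @ \<eta> # as2" "\<eta> \<in> W" "\<forall>w\<in>set as2. w \<notin> W"
      using split_list_last_prop[of as "\<lambda>w. w \<in> W"] by auto
    let ?\<omega>1 = "\<eta> # as2 @ [\<zeta>]"
    have "is_path P \<eta> ?\<omega>1 \<zeta>"
      using is_path_suffix[of P m as1 \<eta> "as2 @ [\<zeta>]" \<zeta>] to_\<zeta> by (simp add: as(1))
    moreover have "path_max H (path_concat ?\<omega>1 (\<zeta> # \<rho>)) \<le> \<Gamma> + H m"
      using below \<rho>(2) by (subst path_max_le_iff) (auto simp: path_concat_def us as(1) less_imp_le)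
    moreover have "set ?\<omega>1 \<inter> W = {\<eta>}" using as \<zeta>(3) by auto
    moreover have "set ?\<omega>1 \<inter> stable_cycle H P m \<Gamma> = {}" using outside by (auto simp: us as(1))
    ultimately have "\<zeta> \<in> K_tilde H P m \<Gamma> W"
      unfolding K_tilde_def using \<zeta>(2,3) as(2) s exit_path exit_W by blast
    then show False using \<zeta>(4) by contradiction
  qed
qed

text \<open>Every optimal path is rerouted at its first entrance into \<open>C\<close>; the descent inside \<open>C\<close> stays
  below the saddle energy, so it contributes no maximal point.\<close>

lemma second_type_saddle_unessential:
  assumes chain: "metropolis \<beta> q H P"
    and Gamma: "\<Gamma> = comm_height_set H P {m} (stable_states H) - H m"
    and one_cycle: "\<forall>s\<in>stable_states H. \<forall>s'\<in>stable_states H. comm_height H P s s' < \<Gamma> + H m"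
    and gate: "is_gate H P m (stable_states H) W"
    and \<zeta>: "\<zeta> \<in> boundary P (stable_cycle H P m \<Gamma>)"
      "\<zeta> \<in> saddles H P m (stable_states H)" "\<zeta> \<notin> W" "\<zeta> \<notin> K_tilde H P m \<Gamma> W"
  shows "unessential H P m (stable_states H) \<zeta>"
  unfolding unessential_def
proof (intro conjI ballI impI)
  show "\<zeta> \<in> saddles H P m (stable_states H)" by fact
next
  fix \<omega> assume \<omega>: "\<omega> \<in> optimal_paths H P m (stable_states H)"
  obtain w where "w \<in> set \<omega>" "w \<in> W" using gate \<omega> by (auto simp: is_gate_def)
  moreover from this have "w \<in> path_argmax H \<omega>"
    using gate saddle_energy optimal_path_argmax[OF \<omega>] by (fastforce simp: is_gate_def)
  ultimately show "path_argmax H \<omega> - {\<zeta>} \<noteq> {}" using \<zeta>(3) by auto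
next
  fix \<omega> assume \<omega>: "\<omega> \<in> optimal_paths H P m (stable_states H)"
  have h: "comm_height_set H P {m} (stable_states H) = \<Gamma> + H m" using Gamma by simp
  obtain y where y: "y \<in> stable_states H" and path: "is_path P m \<omega> y"
    using \<omega> by (auto simp: optimal_paths_def)
  have "y \<in> set \<omega>" "y \<in> stable_cycle H P m \<Gamma>"
    using y path by (auto simp: is_path_def stable_cycle_def)
  then obtain us c vs where split: "\<omega> = us @ c # vs" "c \<in> stable_cycle H P m \<Gamma>"
      "\<forall>u\<in>set us. u \<notin> stable_cycle H P m \<Gamma>"
    using split_list_first_prop[of \<omega> "\<lambda>z. z \<in> stable_cycle H P m \<Gamma>"] by auto
  obtain s \<rho> where s: "s \<in> stable_states H" and \<rho>: "is_path P c \<rho> s" "\<forall>z\<in>set \<rho>. H z < \<Gamma> + H m"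
    using stable_cycle_descent[OF chain one_cycle split(2)] .
  have below: "\<forall>z\<in>set us. H z \<le> \<Gamma> + H m"
    using optimal_path_bounded[OF \<omega>] by (simp add: split(1) h)
  have "is_path P m (us @ \<rho>) s"
    using is_path_append[OF is_path_prefix \<rho>(1)] path by (simp add: split(1))
  then have opt: "us @ \<rho> \<in> optimal_paths H P m (stable_states H)"
    using s by (rule optimal_pathI) (use below \<rho>(2) in \<open>auto simp: h less_imp_le\<close>)
  have "\<zeta> \<notin> set us"
    using path split(3) below
    by (intro second_type_saddle_not_before_entrance[OF chain Gamma one_cycle gate \<zeta>,
          where vs = "c # vs" and y = y]) (auto simp: split(1))
  then have "path_argmax H (us @ \<rho>) \<subseteq> path_argmax H \<omega> - {\<zeta>}"
    using \<rho>(2) unfolding optimal_path_argmax[OF opt] optimal_path_argmax[OF \<omega>]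
    by (fastforce simp: split(1) h)
  then show "\<exists>\<omega>'\<in>optimal_paths H P m (stable_states H).
      path_argmax H \<omega>' \<subseteq> path_argmax H \<omega> - {\<zeta>}"
    using opt by blast
qed

theorem proposition3p5:
  fixes \<beta> :: real
    and q P :: "'a::finite \<Rightarrow> 'a \<Rightarrow> real"
    and H :: "'a \<Rightarrow> real"
    and m :: 'a
    and \<Gamma> :: real
    and W LG LB :: "'a set"
  assumes chain: "metropolis \<beta> q H P"
    and m: "m \<in> metastable_states H P"
    and Gamma: "\<Gamma> = comm_height_set H P {m} (stable_states H) - H m"
    and one_cycle: "\<forall>s\<in>stable_states H. \<forall>s'\<in>stable_states H. comm_height H P s s' < \<Gamma> + H m"
    and gate: "is_gate H P m (stable_states H) W"
    and a: "\<forall>\<eta>\<in>W.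
        (\<exists>l\<in>LG. \<exists>\<omega>. is_path P \<eta> \<omega> l \<and> path_max H \<omega> \<le> \<Gamma> + H m) \<and>
        (\<forall>l\<in>LG. \<exists>s\<in>stable_states H. \<exists>\<omega>. is_path P l \<omega> s \<and> path_max H \<omega> < \<Gamma> + H m)"
    and b: "\<forall>\<eta>\<in>W.
        (\<exists>l\<in>LB. \<exists>\<omega>. is_path P \<eta> \<omega> l \<and> path_max H \<omega> \<le> \<Gamma> + H m) \<and>
        (\<forall>l\<in>LB.
           \<not> (\<exists>s\<in>stable_states H. \<exists>\<omega>. is_path P l \<omega> s \<and> path_max H \<omega> < \<Gamma> + H m) \<and>
           \<not> (\<exists>\<omega>. is_path P l \<omega> m \<and> path_max H \<omega> < \<Gamma> + H m))"
  shows "\<forall>\<zeta>\<in>boundary P (stable_cycle H P m \<Gamma>) \<inter>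
              (saddles H P m (stable_states H) - (W \<union> K_tilde H P m \<Gamma> W)).
           unessential H P m (stable_states H) \<zeta> \<and>
           \<zeta> \<notin> minimal_gates_union H P m (stable_states H)"
  using second_type_saddle_unessential[OF chain Gamma one_cycle gate]
    unessential_not_in_minimal_gates
  by blast

end
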